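(* Let $s\ge0$ be an integer with $s=k(k+1)+i$ for integers $k\ge0$ and $0\le i\le 2k+1$. Define \[ (x^{even}_s,y^{even}_s)=\begin{cases}(i,\,2(k-i)),&0\le i\le k,\\ (i-k-1,\,4k-2i+3),&k+1\le i\le 2k+1,\end{cases}\qquad (x^{odd}_s,y^{odd}_s)=\begin{cases}(2i,\,k-i),&0\le i\le k,\\ (2(i-k)-1,\,2k-i+1),&k+1\le i\le 2k+1,\end{cases} \] and $N^{even}_s=6\lfloor\sqrt{s+1}\rfloor-6$, $N^{odd}_s=6\left\lfloor\frac{\sqrt{4s+5}-1}{2}\right\rfloor-3$. Let $n$ be a positive integer with $n>N^{even}_s$ if $n$ is even and $n>N^{odd}_s$ if $n$ is odd, and let $(x_s,y_s)=(x^{even}_s,y^{even}_s)$ if $n$ is even and $(x_s,y_s)=(x^{odd}_s,y^{odd}_s)$ if $n$ is odd. Let $t_m=\frac{m(m+1)}{2}$ and $d_1=\gcd(t_{n+1},t_{n+2})$. Then \[ \mathtt{g}\!\left(t_n,\frac{t_{n+1}}{d_1},\frac{t_{n+2}}{d_1};s\right)=\mathtt{g}\!\left(\frac{t_{n+1}}{d_1},\frac{t_{n+2}}{d_1};x_s\right)+y_s t_n=(x_s+1)\frac{t_{n+2}t_{n+1}}{d_1^2}-\frac{t_{n+2}}{d_1}-\frac{t_{n+1}}{d_1}+y_s t_n . \]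
   Context: For positive integers $a_1,\dots,a_k$ with $\gcd(a_1,\dots,a_k)=1$ and an integer $m$, $\operatorname{d}(m;a_1,\dots,a_k)$ denotes the number of tuples of non-negative integers $(x_1,\dots,x_k)$ with $a_1x_1+\dots+a_kx_k=m$ (zero if $m<0$). For an integer $s\ge0$, $\mathtt{g}(a_1,\dots,a_k;s)=\max\{m\in\mathbb{Z}:\operatorname{d}(m;a_1,\dots,a_k)\le s\}$ (generalized Frobenius number). *)

theory Defs
  imports Complex_Main "HOL-Library.Nat_Bijection"
begin

(* Intended for lists of positive entries only: a zero entry can make the solution
   set infinite, and card would then return 0.  For m < 0 the value is 0. *)
definition denumerant :: "int \<Rightarrow> nat list \<Rightarrow> nat" where
  "denumerant m as =
     card {xs :: nat list. length xs = length as \<and>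
                           int (\<Sum>j<length as. as ! j * xs ! j) = m}"

(* The maximum ranges over all integers, so the value may be negative:
   g(1, a_2, ..., a_k; 0) = -1.  GREATEST rather than Max, because the set contains
   all negative integers.  It has a maximum when the entries are positive with gcd 1;
   otherwise the value is unspecified. *)
definition gen_frobenius :: "nat list \<Rightarrow> int \<Rightarrow> int" where
  "gen_frobenius as s = (GREATEST m :: int. int (denumerant m as) \<le> s)"

(* The pair (x_s, y_s) for s = k * (k + 1) + i with 0 \<le> k and 0 \<le> i \<le> 2 * k + 1;
   these constraints determine k and i from s. *)
definition xy_even :: "int \<Rightarrow> int \<Rightarrow> int \<times> int" where
  "xy_even k i = (if i \<le> k then (i, 2 * (k - i)) else (i - k - 1, 4 * k - 2 * i + 3))"

definition xy_odd :: "int \<Rightarrow> int \<Rightarrow> int \<times> int" where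
  "xy_odd k i = (if i \<le> k then (2 * i, k - i) else (2 * (i - k) - 1, 2 * k - i + 1))"

definition N_even :: "int \<Rightarrow> int" where
  "N_even s = 6 * \<lfloor>sqrt (real_of_int (s + 1))\<rfloor> - 6"

definition N_odd :: "int \<Rightarrow> int" where
  "N_odd s = 6 * \<lfloor>(sqrt (real_of_int (4 * s + 5)) - 1) / 2\<rfloor> - 3"

end

theory Submission
  imports Defs "HOL-Number_Theory.Cong"
begin

text \<open>
  Write \<open>A\<close>, \<open>B\<close> for the two quotients; they are coprime and \<open>t\<^sub>n = c A\<close>. Every integer is
  \<open>m = B r + A q\<close> with \<open>0 \<le> r < A\<close>, and the representations of \<open>m\<close> by \<open>c A\<close>, \<open>A\<close>, \<open>B\<close> correspond
  to the pairs \<open>(l, j)\<close> of naturals with \<open>B l + c j \<le> q\<close>. The number of such pairs is monotone in \<open>q\<close>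
  and does not depend on \<open>r\<close>, so the maximal \<open>m\<close> has \<open>r = A - 1\<close>, and \<open>q + 1\<close> is the value of
  \<open>B l + c j\<close> at the pair of rank \<open>s\<close>, counting from \<open>0\<close>. For even \<open>n\<close> we have
  \<open>B = 2 c + 3\<close>, so \<open>B l + c j = (2 l + j) c + 3 l\<close>; for odd \<open>n\<close> we have \<open>c = 2 B - 3\<close>, so
  \<open>B l + c j = (l + 2 j) B - 3 j\<close>. The lower bound on \<open>n\<close> makes the order lexicographic
  (by level \<open>2 l + j\<close> or \<open>l + 2 j\<close> first) as far as comparisons with the pair \<open>(x\<^sub>s, y\<^sub>s)\<close> are
  concerned, and its rank is then a count of lattice points.
\<close>

section \<open>Frobenius numbers from a count independent of the residue\<close>

lemma residue_decomposition:
  fixes A B :: nat and m :: int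
  assumes "A > 0" and "coprime A B"
  obtains r :: nat and q :: int where "r < A" and "m = int (B * r) + int A * q"
proof -
  have "coprime (int B) (int A)"
    using assms(2) by (simp add: coprime_commute)
  then obtain z where z: "[int B * z = 1] (mod int A)"
    using cong_solve_coprime_int by blast
  \<comment> \<open>\<open>z\<close> inverts \<open>B\<close> modulo \<open>A\<close>, so this
    residue satisfies B r = m modulo \<open>A\<close>.\<close>
  define r where "r = nat ((z * m) mod int A)"
  have r: "int r = (z * m) mod int A"
    using assms(1) by (simp add: r_def)
  have "[int r = z * m] (mod int A)"
    by (simp add: r cong_def)
  then have "[int B * int r = int B * (z * m)] (mod int A)"
    by (rule cong_scalar_left)
  also have "int B * (z * m) = (int B * z) * m"
    by simp
  also have "[(int B * z) * m = 1 * m] (mod int A)"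
    using z by (rule cong_scalar_right)
  finally have "[m = int (B * r)] (mod int A)"
    by (simp add: cong_sym)
  then obtain q where "m = int (B * r) + int A * q"
    by (metis cong_iff_lin cong_sym)
  moreover have "r < A"
    using r assms(1) by (metis of_nat_0_less_iff of_nat_less_iff pos_mod_bound)
  ultimately show ?thesis
    using that by blast
qed

text \<open>\<open>Q\<close> is the first argument at which \<open>D\<close> exceeds
  \<open>s\<close>. By monotonicity every admissible m has q \<le> Q - 1, and the extreme choice is
  q = Q - 1 together with r = A - 1.\<close>

lemma gen_frobenius_eqI:
  fixes A B :: nat and D :: "int \<Rightarrow> nat"
  assumes "A > 0" and "coprime A B"
    and den: "\<And>r q. r < A \<Longrightarrow> denumerant (int (B * r) + int A * q) as = D q"
    and "mono D" and "int (D (Q - 1)) \<le> s" and "s < int (D Q)"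
  shows "gen_frobenius as s = int A * int B - int A - int B + int A * Q"
proof -
  have top: "int A * int B - int A - int B + int A * Q = int (B * (A - 1)) + int A * (Q - 1)"
    using assms(1) by (simp add: of_nat_diff algebra_simps)
  show ?thesis
    unfolding gen_frobenius_def top
  proof (rule Greatest_equality)
    show "int (denumerant (int (B * (A - 1)) + int A * (Q - 1)) as) \<le> s"
      using den[of "A - 1" "Q - 1"] assms(1,5) by simp
  next
    fix m assume m: "int (denumerant m as) \<le> s"
    obtain r q where r: "r < A" and q: "m = int (B * r) + int A * q"
      using residue_decomposition[OF assms(1,2)] .
    have "int (D q) \<le> s"
      using m unfolding q den[OF r] .
    then have "D q < D Q"
      using assms(6) by linarith
    then have "q \<le> Q - 1"
      using monoD[OF assms(4), of Q q] by linarith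
    then have "int A * q \<le> int A * (Q - 1)"
      by (simp add: mult_left_mono)
    moreover have "int (B * r) \<le> int (B * (A - 1))"
      using r by (intro of_nat_mono mult_le_mono2) simp
    ultimately show "m \<le> int (B * (A - 1)) + int A * (Q - 1)"
      using q by linarith
  qed
qed

section \<open>Denumerants as counts of lattice points\<close>

text \<open>Modulo \<open>A\<close> the equation forces z = r, and \<open>r < A\<close> makes the
  quotient nonnegative. \<open>e\<close> stands for the contribution of the generators divisible by
  \<open>A\<close>, divided by \<open>A\<close>, so that two and three generators are treated
  alike.\<close>

lemma coprime_cong_decomposition:
  fixes A B r z :: nat and e q :: int
  assumes "coprime A B" and "r < A" and "int A * e + int B * int z = int (B * r) + int A * q"
  obtains l where "z = r + A * l" and "e + int B * int l = q"
proof -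
  have eq: "int B * (int z - int r) = int A * (q - e)"
    using assms(3) by (simp add: algebra_simps)
  then have "int A dvd int B * (int z - int r)"
    by simp
  moreover have "coprime (int A) (int B)"
    using assms(1) by simp
  ultimately have "int A dvd int z - int r"
    by (simp add: coprime_dvd_mult_right_iff)
  then obtain t where t: "int z - int r = int A * t" ..
  have "t \<ge> 0"
  proof (rule ccontr)
    assume "\<not> t \<ge> 0"
    then have "int A * t \<le> int A * (- 1)"
      by (intro mult_left_mono) auto
    then show False
      using t assms(2) by linarith
  qed
  then have z: "z = r + A * nat t"
    using t by (metis add_diff_cancel_left' diff_add_cancel int_nat_eq of_nat_add of_nat_eq_iff
        of_nat_mult add.commute)
  have "int A * (int B * t) = int A * (q - e)"
    using eq t by (simp add: algebra_simps)
  then have "int B * t = q - e"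
    using assms(2) by simp
  then show ?thesis
    using that[OF z] \<open>t \<ge> 0\<close> by simp
qed

text \<open>\<open>l\<close> fixes the coefficient r + A l of \<open>B\<close>; the coefficient of
  \<open>A\<close> is then q - B l, and the inequality says that it is nonnegative.\<close>

lemma denumerant_two:
  fixes A B r :: nat and q :: int
  assumes "coprime A B" and "r < A"
  shows "denumerant (int (B * r) + int A * q) [A, B] = card {l. int (B * l) \<le> q}"
proof -
  let ?f = "\<lambda>l. [nat (q - int (B * l)), r + A * l]"
  let ?S = "{xs :: nat list. length xs = length [A, B] \<and>
    int (\<Sum>j<length [A, B]. [A, B] ! j * xs ! j) = int (B * r) + int A * q}"
  have "bij_betw ?f {l. int (B * l) \<le> q} ?S"
  proof (rule bij_betwI')
    show "(?f l = ?f l') = (l = l')" for l l'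
      using assms(2) by auto
  next
    fix l assume "l \<in> {l. int (B * l) \<le> q}"
    then have "int (nat (q - int (B * l))) = q - int (B * l)"
      by simp
    then show "?f l \<in> ?S"
      by (simp add: numeral_2_eq_2 algebra_simps del: int_nat_eq)
  next
    fix xs assume "xs \<in> ?S"
    then obtain a b where xs: "xs = [a, b]"
        and eq: "int A * int a + int B * int b = int (B * r) + int A * q"
      by (auto simp: numeral_2_eq_2 length_Suc_conv)
    obtain l where "b = r + A * l" "int a + int B * int l = q"
      using coprime_cong_decomposition[OF assms eq] .
    then show "\<exists>l\<in>{l. int (B * l) \<le> q}. xs = ?f l"
      by (intro bexI[of _ l]) (auto simp: xs)
  qed
  then show ?thesis
    unfolding denumerant_def by (simp add: bij_betw_same_card)
qed

text \<open>As for two generators, with \<open>j\<close> the coefficient of \<open>c * A\<close>;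
  the coefficient of \<open>A\<close> again takes up the slack.\<close>

lemma denumerant_three:
  fixes A B c r :: nat and q :: int
  assumes "coprime A B" and "r < A"
  shows "denumerant (int (B * r) + int A * q) [c * A, A, B]
    = card {(l, j). int (B * l + c * j) \<le> q}"
proof -
  let ?f = "\<lambda>(l, j). [j, nat (q - int (B * l + c * j)), r + A * l]"
  let ?S = "{xs :: nat list. length xs = length [c * A, A, B] \<and>
    int (\<Sum>j<length [c * A, A, B]. [c * A, A, B] ! j * xs ! j) = int (B * r) + int A * q}"
  have "bij_betw ?f {(l, j). int (B * l + c * j) \<le> q} ?S"
  proof (rule bij_betwI')
    show "(?f p = ?f p') = (p = p')" for p p'
      using assms(2) by (auto split: prod.splits)
  next
    fix p assume "p \<in> {(l, j). int (B * l + c * j) \<le> q}"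
    then obtain l j where p: "p = (l, j)" and "int (B * l + c * j) \<le> q"
      by auto
    then have "int (nat (q - int (B * l + c * j))) = q - int (B * l + c * j)"
      by simp
    then show "?f p \<in> ?S"
      by (simp add: p numeral_3_eq_3 algebra_simps del: int_nat_eq)
  next
    fix xs assume "xs \<in> ?S"
    then obtain j a b where xs: "xs = [j, a, b]"
        and eq: "int A * (int c * int j + int a) + int B * int b = int (B * r) + int A * q"
      by (auto simp: numeral_3_eq_3 length_Suc_conv algebra_simps)
    obtain l where "b = r + A * l" "int c * int j + int a + int B * int l = q"
      using coprime_cong_decomposition[OF assms eq] .
    then show "\<exists>p\<in>{(l, j). int (B * l + c * j) \<le> q}. xs = ?f p"
      by (intro bexI[of _ "(l, j)"]) (auto simp: xs)
  qed
  then show ?thesis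
    unfolding denumerant_def by (simp add: bij_betw_same_card)
qed

section \<open>Frobenius numbers of two and three generators\<close>

text \<open>The number of l with B l \<le> q first exceeds \<open>x\<close> at q = B x, where l = 0,
  ..., x all qualify.\<close>

lemma gen_frobenius_two:
  fixes A B x :: nat
  assumes "A > 0" and "B > 0" and "coprime A B"
  shows "gen_frobenius [A, B] (int x) = (int x + 1) * int (A * B) - int A - int B"
proof -
  let ?D = "\<lambda>q. card {l. int (B * l) \<le> q}"
  have fin: "finite {l. int (B * l) \<le> q}" for q
  proof (rule finite_subset)
    show "{l. int (B * l) \<le> q} \<subseteq> {..nat q}"
    proof clarsimp
      fix l assume "int B * int l \<le> q"
      moreover have "int l \<le> int B * int l"
        using assms(2) by (simp add: mult_le_cancel_right1)
      ultimately show "l \<le> nat q"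
        by linarith
    qed
  qed simp
  have "gen_frobenius [A, B] (int x) = int A * int B - int A - int B + int A * int (B * x)"
  proof (rule gen_frobenius_eqI[where D = ?D])
    show "mono ?D"
      by (rule monoI) (intro card_mono fin, auto)
    have "{l. int (B * l) \<le> int (B * x) - 1} \<subseteq> {..<x}"
    proof clarify
      fix l assume "int (B * l) \<le> int (B * x) - 1"
      then have "B * l < B * x" by linarith
      then show "l < x" by simp
    qed
    then have "?D (int (B * x) - 1) \<le> card {..<x}"
      by (rule card_mono[OF finite_lessThan])
    then show "int (?D (int (B * x) - 1)) \<le> int x"
      unfolding card_lessThan by linarith
    have "{..x} \<subseteq> {l. int (B * l) \<le> int (B * x)}"
      by (auto simp del: of_nat_mult)
    then have "card {..x} \<le> ?D (int (B * x))"
      by (rule card_mono[OF fin])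
    then show "int x < int (?D (int (B * x)))"
      unfolding card_atMost by linarith
  qed (use assms denumerant_two in auto)
  then show ?thesis
    by (simp add: algebra_simps)
qed

text \<open>\<open>L\<close> consists of the pairs ranked before (x, y). Just below the value of (x,
  y) only pairs of \<open>L\<close> are counted; at that value (x, y) and all of \<open>L\<close>
  are. Both comparisons are weak, so a pair of equal value may lie on either side.\<close>

lemma gen_frobenius_three:
  fixes A B c x y :: nat
  assumes "A > 0" and "B > 0" and "c > 0" and "coprime A B"
    and L: "finite L" "(x, y) \<notin> L"
    and below: "\<And>l j. (l, j) \<in> L \<Longrightarrow> B * l + c * j \<le> B * x + c * y"
    and above: "\<And>l j. (l, j) \<notin> L \<Longrightarrow> B * x + c * y \<le> B * l + c * j"
  shows "gen_frobenius [c * A, A, B] (int (card L))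
    = gen_frobenius [A, B] (int x) + int y * int (c * A)"
proof -
  let ?S = "\<lambda>q. {(l, j). int (B * l + c * j) \<le> q}"
  let ?Q = "int (B * x + c * y)"
  have fin: "finite (?S q)" for q
  proof (rule finite_subset)
    show "?S q \<subseteq> {..nat q} \<times> {..nat q}"
    proof clarsimp
      fix l j assume "int B * int l + int c * int j \<le> q"
      moreover have "int l \<le> int B * int l" "int j \<le> int c * int j"
        using assms(2,3) by (simp_all add: mult_le_cancel_right1)
      ultimately show "l \<le> nat q \<and> j \<le> nat q"
        by linarith
    qed
  qed simp
  have "gen_frobenius [c * A, A, B] (int (card L))
    = int A * int B - int A - int B + int A * ?Q"
  proof (rule gen_frobenius_eqI[where D = "\<lambda>q. card (?S q)"])
    show "mono (\<lambda>q. card (?S q))"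
      by (rule monoI) (intro card_mono fin, auto)
    have "?S (?Q - 1) \<subseteq> L"
    proof clarify
      fix l j assume "int (B * l + c * j) \<le> ?Q - 1"
      then have "\<not> B * x + c * y \<le> B * l + c * j" by linarith
      then show "(l, j) \<in> L" using above by blast
    qed
    then show "int (card (?S (?Q - 1))) \<le> int (card L)"
      using L(1) by (intro of_nat_mono card_mono)
    have "insert (x, y) L \<subseteq> ?S ?Q"
      using below by (auto simp del: of_nat_mult of_nat_add)
    then have "card (insert (x, y) L) \<le> card (?S ?Q)"
      by (intro card_mono fin)
    then show "int (card L) < int (card (?S ?Q))"
      using L by simp
  qed (use assms denumerant_three in auto)
  then show ?thesis
    using assms by (simp add: gen_frobenius_two algebra_simps)
qed

section \<open>Counting lattice points by level\<close>

lemma card_level_image: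
  fixes u :: nat and M :: "nat set"
  assumes "M \<subseteq> {..u div 2}"
  shows "card {(l, j). 2 * l + j = u \<and> l \<in> M} = card M"
proof -
  have "{(l, j). 2 * l + j = u \<and> l \<in> M} = (\<lambda>l. (l, u - 2 * l)) ` M"
    using assms by (force simp: image_iff)
  then show ?thesis
    by (simp add: card_image inj_on_def)
qed

lemma finite_levels_below: "finite {(l, j). 2 * l + j < (u :: nat)}"
  by (rule finite_subset[of _ "{..u} \<times> {..u}"]) auto

lemma card_levels_below: "card {(l, j). 2 * l + j < (u :: nat)} = (\<Sum>v<u. v div 2 + 1)"
proof (induction u)
  case 0
  then show ?case by simp
next
  case (Suc u)
  have "{(l, j). 2 * l + j < Suc u}
      = {(l, j). 2 * l + j < u} \<union> {(l, j). 2 * l + j = u \<and> l \<in> {..u div 2}}"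
    by auto
  moreover have "finite {(l, j). 2 * l + j = u \<and> l \<in> {..u div 2}}"
    by (rule finite_subset[OF _ finite_levels_below[of "Suc u"]]) auto
  ultimately have "card {(l, j). 2 * l + j < Suc u}
      = card {(l, j). 2 * l + j < u} + card {(l, j). 2 * l + j = u \<and> l \<in> {..u div 2}}"
    using finite_levels_below[of u] by (simp add: card_Un_disjoint disjoint_iff)
  then show ?case
    using Suc card_level_image[of "{..u div 2}" u] by simp
qed

text \<open>Levels 2 a and 2 a + 1 contain a + 1 pairs each, which gives 2 (1 + ... + k). This is
  the source of k (k + 1) in the parametrization of \<open>s\<close>.\<close>

lemma sum_half_even: "(\<Sum>v<2 * k. v div 2 + 1) = k * (k + 1)" for k :: nat
  by (induction k) auto

text \<open>\<open>M\<close> is left open because the order inside the top level depends on parity: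
  increasing in the doubled coordinate for even n, decreasing for odd n.\<close>

lemma lex_initial_segment:
  fixes u :: nat and M :: "nat set"
  assumes "M \<subseteq> {..u div 2}"
  defines "L \<equiv> {(l, j). 2 * l + j < u \<or> 2 * l + j = u \<and> l \<in> M}"
  shows "finite L" and "card L = (\<Sum>v<u. v div 2 + 1) + card M"
proof -
  show fin: "finite L"
    unfolding L_def by (rule finite_subset[OF _ finite_levels_below[of "Suc u"]]) auto
  have L: "L = {(l, j). 2 * l + j < u} \<union> {(l, j). 2 * l + j = u \<and> l \<in> M}"
    by (auto simp: L_def)
  then have "card L = card {(l, j). 2 * l + j < u} + card {(l, j). 2 * l + j = u \<and> l \<in> M}"
    using fin by (simp add: card_Un_disjoint disjoint_iff)
  then show "card L = (\<Sum>v<u. v div 2 + 1) + card M"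
    by (simp add: card_levels_below card_level_image[OF assms(1)])
qed

section \<open>Comparison of levels for the two parities\<close>

text \<open>One level is worth c. \<open>hi\<close> compares (x, y) with l = 0 on a higher level,
  \<open>lo\<close> with the largest l on the level just below.\<close>

lemma gen_frobenius_lex_increasing:
  fixes A c x y :: nat
  assumes "A > 0" and "c > 0" and "coprime A (2 * c + 3)"
    and hi: "3 * x \<le> c" and lo: "3 * ((2 * x + y - 1) div 2) \<le> c + 3 * x"
  shows "gen_frobenius [c * A, A, 2 * c + 3] (int ((\<Sum>v<2 * x + y. v div 2 + 1) + x))
    = gen_frobenius [A, 2 * c + 3] (int x) + int y * int (c * A)"
proof -
  let ?L = "{(l, j). 2 * l + j < 2 * x + y \<or> 2 * l + j = 2 * x + y \<and> l \<in> {..<x}}"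
  have sub: "{..<x} \<subseteq> {..(2 * x + y) div 2}" by auto
  have val: "(2 * c + 3) * l + c * j = (2 * l + j) * c + 3 * l" for l j
    by (simp add: algebra_simps)
  have "gen_frobenius [c * A, A, 2 * c + 3] (int (card ?L))
    = gen_frobenius [A, 2 * c + 3] (int x) + int y * int (c * A)"
  proof (rule gen_frobenius_three)
    show "finite ?L" by (rule lex_initial_segment(1)[OF sub])
  next
    fix l j assume L: "(l, j) \<in> ?L"
    show "(2 * c + 3) * l + c * j \<le> (2 * c + 3) * x + c * y"
    proof (cases "2 * l + j < 2 * x + y")
      case True
      then obtain d where d: "2 * x + y = 2 * l + j + 1 + d"
        using less_iff_Suc_add by (metis Suc_eq_plus1 add.assoc add.commute)
      have "l \<le> (2 * x + y - 1) div 2" using d by linarith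
      then have "3 * l \<le> c + 3 * x" using lo by linarith
      then show ?thesis
        unfolding val d by (simp add: add_mult_distrib)
    next
      case False
      then have "2 * l + j = 2 * x + y" "l < x" using L by auto
      then show ?thesis unfolding val by simp
    qed
  next
    fix l j assume L: "(l, j) \<notin> ?L"
    show "(2 * c + 3) * x + c * y \<le> (2 * c + 3) * l + c * j"
    proof (cases "2 * l + j > 2 * x + y")
      case True
      then obtain d where d: "2 * l + j = 2 * x + y + 1 + d"
        using less_iff_Suc_add by (metis Suc_eq_plus1 add.assoc add.commute)
      show ?thesis
        unfolding val d using hi by (simp add: add_mult_distrib)
    next
      case False
      then have "2 * l + j = 2 * x + y" "x \<le> l" using L by auto
      then show ?thesis unfolding val by simp
    qed
  qed (use assms in auto)
  then show ?thesis
    by (simp only: lex_initial_segment(2)[OF sub] card_lessThan)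
qed

text \<open>One level is worth B, and a larger j lowers the value. \<open>lo\<close> compares (x, y)
  with j = 0 on a lower level, \<open>hi\<close> with the largest j on the next level up.\<close>

lemma gen_frobenius_lex_decreasing:
  fixes A B c x y :: nat
  assumes "A > 0" and "c > 0" and "coprime A B" and B: "c + 3 = 2 * B"
    and lo: "3 * y \<le> B" and hi: "3 * ((x + 2 * y + 1) div 2) < B + 3 * y"
  shows "gen_frobenius [c * A, A, B] (int ((\<Sum>v<x + 2 * y. v div 2 + 1) + x div 2))
    = gen_frobenius [A, B] (int x) + int y * int (c * A)"
proof -
  let ?u = "x + 2 * y"
  let ?M = "{y<..?u div 2}"
  \<comment> \<open>The level counts expect the doubled coordinate first, which here is
    \<open>j\<close>; the swap restores the order (l, j).\<close>
  let ?L = "{(j, l). 2 * j + l < ?u \<or> 2 * j + l = ?u \<and> j \<in> ?M}"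
  let ?L' = "prod.swap ` ?L"
  have sub: "?M \<subseteq> {..?u div 2}" by auto
  have val: "B * l + c * j + 3 * j = (2 * j + l) * B" for l j
  proof -
    have "B * l + (c + 3) * j = (2 * j + l) * B"
      unfolding B by (simp add: algebra_simps)
    then show ?thesis by (simp add: algebra_simps)
  qed
  have "B \<ge> 2" using B \<open>c > 0\<close> by linarith
  have mem: "(l, j) \<in> ?L' \<longleftrightarrow> 2 * j + l < ?u \<or> 2 * j + l = ?u \<and> y < j" for l j
    by (auto simp: image_iff)
  have "gen_frobenius [c * A, A, B] (int (card ?L'))
    = gen_frobenius [A, B] (int x) + int y * int (c * A)"
  proof (rule gen_frobenius_three)
    show "finite ?L'" using lex_initial_segment(1)[OF sub] by simp
    show "(x, y) \<notin> ?L'" unfolding mem by simp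
  next
    fix l j assume L: "(l, j) \<in> ?L'"
    have "(2 * j + l) * B + 3 * y \<le> (2 * y + x) * B + 3 * j"
    proof (cases "2 * j + l < ?u")
      case True
      then have "(2 * j + l + 1) * B \<le> (2 * y + x) * B"
        by (intro mult_le_mono1) simp
      then show ?thesis
        using lo by (simp add: add_mult_distrib)
    next
      case False
      then have "2 * j + l = 2 * y + x" "y < j" using L unfolding mem by auto
      then show ?thesis by simp
    qed
    then show "B * l + c * j \<le> B * x + c * y"
      using val[of l j] val[of x y] by linarith
  next
    fix l j assume L: "(l, j) \<notin> ?L'"
    have "(2 * y + x) * B + 3 * j \<le> (2 * j + l) * B + 3 * y"
    proof (cases "2 * j + l > ?u")
      case True
      then obtain d where d: "2 * j + l = 2 * y + x + 1 + d"
        using less_iff_Suc_add by (metis Suc_eq_plus1 add.assoc add.commute)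
      have "2 * d \<le> d * B" using \<open>B \<ge> 2\<close> by simp
      \<comment> \<open>Climbing d further levels raises the largest j by at most (d + 1) div 2,
        hence 3 j by at most 2 d + 1. The 2 d is paid for by \<open>B \<ge> 2\<close>, the 1 by the
        strictness of \<open>hi\<close>.\<close>
      moreover have "3 * j \<le> 3 * ((?u + 1) div 2) + 2 * d + 1"
      proof -
        have "?u + 1 \<le> 2 * ((?u + 1) div 2) + 1" by simp
        then show ?thesis using d by (cases d) linarith+
      qed
      ultimately have "3 * j \<le> B + d * B + 3 * y" using hi by linarith
      then show ?thesis
        unfolding d by (simp add: add_mult_distrib)
    next
      case False
      then have "2 * j + l = 2 * y + x" "j \<le> y" using L unfolding mem by auto
      then show ?thesis by simp
    qed
    then show "B * x + c * y \<le> B * l + c * j"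
      using val[of l j] val[of x y] by linarith
  qed (use assms(1-3) \<open>B \<ge> 2\<close> in auto)
  \<comment> \<open>The top level contributes (x + 2 y) div 2 - y = x div 2.\<close>
  moreover have "card ?L' = (\<Sum>v<?u. v div 2 + 1) + x div 2"
    using lex_initial_segment(2)[OF sub] by (simp add: card_image)
  ultimately show ?thesis by simp
qed

section \<open>Triangular numbers and their quotients\<close>

lemma triangle_eqI: "n * Suc n = 2 * q \<Longrightarrow> triangle n = q"
  by (simp only: triangle_def)

text \<open>The gcd is m + 1, since 2 m + 1 and 2 m + 3 are odd and differ by 2. Hence c = m and B =
  2 c + 3.\<close>

lemma triangle_quotients_even:
  fixes m :: nat
  defines "n \<equiv> 2 * m"
  defines "d \<equiv> gcd (triangle (n + 1)) (triangle (n + 2))"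
  shows "triangle n = m * (2 * m + 1)" and "triangle (n + 1) div d = 2 * m + 1"
    and "triangle (n + 2) div d = 2 * m + 3" and "coprime (2 * m + 1) (2 * m + 3)"
proof -
  have t: "triangle (n + 1) = (m + 1) * (2 * m + 1)" "triangle (n + 2) = (m + 1) * (2 * m + 3)"
    by (rule triangle_eqI, simp add: n_def algebra_simps)+
  show cop: "coprime (2 * m + 1) (2 * m + 3)"
  proof -
    have "coprime (2 * m + 1) ((2 * m + 1) + 2)"
      by (simp only: coprime_iff_gcd_eq_1 gcd_add2) (simp flip: coprime_iff_gcd_eq_1)
    then show ?thesis by (simp add: numeral_3_eq_3)
  qed
  have d: "d = m + 1"
    unfolding d_def t gcd_mult_distrib_nat[symmetric] using cop by simp
  show "triangle n = m * (2 * m + 1)"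
    by (rule triangle_eqI) (simp add: n_def algebra_simps)
  show "triangle (n + 1) div d = 2 * m + 1" "triangle (n + 2) div d = 2 * m + 3"
    unfolding t d by (simp_all del: mult_Suc mult_Suc_right add: add.commute)
qed

text \<open>The gcd is 2 m + 3, since m + 1 and m + 2 are consecutive. Hence c = 2 m + 1 = 2 B -
  3.\<close>

lemma triangle_quotients_odd:
  fixes m :: nat
  defines "n \<equiv> 2 * m + 1"
  defines "d \<equiv> gcd (triangle (n + 1)) (triangle (n + 2))"
  shows "triangle n = (2 * m + 1) * (m + 1)" and "triangle (n + 1) div d = m + 1"
    and "triangle (n + 2) div d = m + 2" and "coprime (m + 1) (m + 2)"
proof -
  have t: "triangle n = (2 * m + 1) * (m + 1)" "triangle (n + 1) = (2 * m + 3) * (m + 1)"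
      "triangle (n + 2) = (2 * m + 3) * (m + 2)"
    by (rule triangle_eqI, simp add: n_def algebra_simps)+
  show cop: "coprime (m + 1) (m + 2)"
    using coprime_Suc_right_nat[of "m + 1"] by simp
  have d: "d = 2 * m + 3"
    unfolding d_def t gcd_mult_distrib_nat[symmetric] using cop by simp
  show "triangle n = (2 * m + 1) * (m + 1)" by (rule t)
  show "triangle (n + 1) div d = m + 1" "triangle (n + 2) div d = m + 2"
    unfolding t d by (simp_all del: mult_Suc mult_Suc_right)
qed

section \<open>Using the lower bound on n\<close>

text \<open>Lets the bound on n be applied through any suitable f, without evaluating the
  floor.\<close>

lemma le_N_even:
  assumes "f \<ge> 0" and "f ^ 2 \<le> s + 1"
  shows "6 * f - 6 \<le> N_even s"
proof -
  have "(real_of_int f)\<^sup>2 \<le> real_of_int (s + 1)"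
    using assms(2) by (metis of_int_le_iff of_int_power)
  then have "f \<le> \<lfloor>sqrt (real_of_int (s + 1))\<rfloor>"
    by (simp only: le_floor_iff real_le_rsqrt)
  then show ?thesis
    by (simp add: N_even_def)
qed

text \<open>The condition on f amounts to (2 f + 1)^2 \<le> 4 s + 5.\<close>

lemma le_N_odd:
  assumes "f \<ge> 0" and "f * (f + 1) \<le> s + 1"
  shows "6 * f - 3 \<le> N_odd s"
proof -
  have "(2 * f + 1) ^ 2 \<le> 4 * s + 5"
    using assms(2) by (simp add: power2_eq_square algebra_simps)
  then have "(real_of_int (2 * f + 1))\<^sup>2 \<le> real_of_int (4 * s + 5)"
    by (metis of_int_le_iff of_int_power)
  then have "real_of_int (2 * f + 1) \<le> sqrt (real_of_int (4 * s + 5))"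
    by (rule real_le_rsqrt)
  then have "f \<le> \<lfloor>(sqrt (real_of_int (4 * s + 5)) - 1) / 2\<rfloor>"
    by (simp add: le_floor_iff)
  then show ?thesis
    by (simp add: N_odd_def)
qed

section \<open>Locating the pair of rank s\<close>

theorem theorem2p8:
  fixes s k i x y :: int and n d1 :: nat
  assumes "s \<ge> 0" and "k \<ge> 0" and "0 \<le> i" and "i \<le> 2 * k + 1"
    and "s = k * (k + 1) + i"
    and "n > 0"
    and "even n \<Longrightarrow> int n > N_even s"
    and "odd n \<Longrightarrow> int n > N_odd s"
    and "(x, y) = (if even n then xy_even k i else xy_odd k i)"
    and "d1 = gcd (triangle (n + 1)) (triangle (n + 2))"
  shows "gen_frobenius [triangle n, triangle (n + 1) div d1, triangle (n + 2) div d1] s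
           = gen_frobenius [triangle (n + 1) div d1, triangle (n + 2) div d1] x
             + y * int (triangle n)
       \<and> gen_frobenius [triangle (n + 1) div d1, triangle (n + 2) div d1] x
             + y * int (triangle n)
           = (x + 1) * int (triangle (n + 2) * triangle (n + 1) div d1 ^ 2)
             - int (triangle (n + 2) div d1) - int (triangle (n + 1) div d1)
             + y * int (triangle n)"
proof -
  define A where "A = triangle (n + 1) div d1"
  define B where "B = triangle (n + 2) div d1"
  obtain k' i' where k: "k = int k'" and i: "i = int i'"
    using assms(2,3) by (metis nonneg_eq_int)
  have i_le: "i' \<le> 2 * k' + 1"
    using assms(4) k i by linarith
  have s: "s = int (k' * (k' + 1) + i')"
    using assms(5) k i by (simp add: algebra_simps)
  have sum_odd: "(\<Sum>v<2 * k' + 1. v div 2 + 1) = k' * (k' + 1) + k' + 1"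
    using sum_half_even[of k'] by simp
  have "A > 0 \<and> B > 0 \<and> coprime A B \<and> x \<ge> 0 \<and>
    gen_frobenius [triangle n, A, B] s = gen_frobenius [A, B] x + y * int (triangle n)"
  proof (cases "even n")
    case True
    then obtain m where n: "n = 2 * m" by blast
    note tri = triangle_quotients_even[of m]
    have AB: "A = 2 * m + 1" "B = 2 * m + 3"
      by (simp_all only: A_def B_def assms(10) n tri(2,3))
    have tn: "triangle n = m * (2 * m + 1)"
      by (simp only: n tri(1))
    have m: "m > 0" using \<open>n > 0\<close> n by simp
    have xy: "(x, y) = xy_even k i" using assms(9) True by simp
    \<comment> \<open>This is n > 6 f - 6 halved; \<open>m > 0\<close> covers f = 0, where the
      natural difference is 0.\<close>
    have bound: "m > 3 * f - 3" if "f ^ 2 \<le> k' * (k' + 1) + i' + 1" for f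
    proof -
      have "int f ^ 2 \<le> s + 1"
        using that unfolding s by (metis of_nat_1 of_nat_add of_nat_le_iff of_nat_power)
      then show ?thesis
        using le_N_even[of "int f" s] assms(7)[OF True] m n by linarith
    qed
    have b0: "m > 3 * k' - 3"
      by (rule bound) (simp add: power2_eq_square)
    \<comment> \<open>(k' + 1)^2 \<le> s + 1 holds exactly when k' \<le> i'.\<close>
    have b1: "m > 3 * k'" if "k' \<le> i'"
      using bound[of "k' + 1"] that by (simp add: power2_eq_square)
    have frob: "gen_frobenius [triangle n, A, B] s = gen_frobenius [A, B] x + y * int (triangle n)"
      if "x = int x'" "y = int y'" "3 * x' \<le> m" "3 * ((2 * x' + y' - 1) div 2) \<le> m + 3 * x'"
        "(\<Sum>v<2 * x' + y'. v div 2 + 1) + x' = k' * (k' + 1) + i'" for x' y'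
      unfolding tn AB s that(1,2) that(5)[symmetric]
      by (rule gen_frobenius_lex_increasing) (use that(3,4) m tri(4) in simp_all)
    have "x \<ge> 0 \<and> gen_frobenius [triangle n, A, B] s = gen_frobenius [A, B] x + y * int (triangle n)"
    proof (cases "i' \<le> k'")
      case True
      \<comment> \<open>Level 2 k' is preceded by k' (k' + 1) pairs, so the pair sought is the one
        with l = i' on it.\<close>
      have u: "2 * i' + 2 * (k' - i') = 2 * k'" using True by simp
      have "x = int i'" "y = int (2 * (k' - i'))"
        using xy True by (auto simp: xy_even_def k i of_nat_diff)
      moreover have "3 * i' \<le> m"
        using True b0 b1 by (cases "i' = k'") auto
      moreover have "3 * ((2 * i' + 2 * (k' - i') - 1) div 2) \<le> m + 3 * i'"
        unfolding u using b0 by linarith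
      ultimately show ?thesis
        using frob[of i' "2 * (k' - i')"] unfolding u sum_half_even by simp
    next
      case False
      \<comment> \<open>Level 2 k' is exhausted after k' + 1 pairs; \<open>x'\<close> is the
        position on level 2 k' + 1, counted from 0.\<close>
      define x' where "x' = i' - (k' + 1)"
      have i': "i' = x' + k' + 1" using False by (simp add: x'_def)
      have le: "x' \<le> k'" using i_le i' by simp
      have u: "2 * x' + (2 * (k' - x') + 1) = 2 * k' + 1" using le by simp
      have "x = int x'" "y = int (2 * (k' - x') + 1)"
        using xy False le by (auto simp: xy_even_def k i i' of_nat_diff)
      moreover have "3 * x' \<le> m"
        using b1 le i' by simp
      moreover have "3 * ((2 * x' + (2 * (k' - x') + 1) - 1) div 2) \<le> m + 3 * x'"
        unfolding u using b1 i' by simp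
      ultimately show ?thesis
        using frob[of x' "2 * (k' - x') + 1"] unfolding u sum_odd i' by simp
    qed
    then show ?thesis
      using AB tri(4) by simp
  next
    case False
    then obtain m where n: "n = 2 * m + 1" by (elim oddE)
    note tri = triangle_quotients_odd[of m]
    have AB: "A = m + 1" "B = m + 2"
      by (simp_all only: A_def B_def assms(10) n tri(2,3))
    have tn: "triangle n = (2 * m + 1) * (m + 1)"
      by (simp only: n tri(1))
    have xy: "(x, y) = xy_odd k i" using assms(9) False by simp
    have bound: "m + 2 > 3 * f" if "f * (f + 1) \<le> k' * (k' + 1) + i' + 1" for f
    proof -
      have "int f * (int f + 1) \<le> s + 1"
        using that unfolding s by (metis of_nat_1 of_nat_add of_nat_le_iff of_nat_mult)
      then show ?thesis
        using le_N_odd[of "int f" s] assms(8)[OF False] n by linarith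
    qed
    have b0: "m + 2 > 3 * k'"
      by (rule bound) simp
    \<comment> \<open>(k' + 1) (k' + 2) \<le> s + 1 requires i' \<ge> 2 k' + 1, so only the last i'
      gains this stronger bound.\<close>
    have b1: "m + 2 > 3 * (k' + 1)" if "i' = 2 * k' + 1"
      using bound[of "k' + 1"] that by simp
    have frob: "gen_frobenius [triangle n, A, B] s = gen_frobenius [A, B] x + y * int (triangle n)"
      if "x = int x'" "y = int y'" "3 * y' \<le> m + 2" "3 * ((x' + 2 * y' + 1) div 2) < m + 2 + 3 * y'"
        "(\<Sum>v<x' + 2 * y'. v div 2 + 1) + x' div 2 = k' * (k' + 1) + i'" for x' y'
      unfolding tn AB s that(1,2) that(5)[symmetric]
      by (rule gen_frobenius_lex_decreasing) (use that(3,4) tri(4) in simp_all)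
    have "x \<ge> 0 \<and> gen_frobenius [triangle n, A, B] s = gen_frobenius [A, B] x + y * int (triangle n)"
    proof (cases "i' \<le> k'")
      case True
      \<comment> \<open>On level 2 k' the pairs are ordered by falling j from j = k', so position i'
        has j = k' - i'.\<close>
      have u: "2 * i' + 2 * (k' - i') = 2 * k'" using True by simp
      have "x = int (2 * i')" "y = int (k' - i')"
        using xy True by (auto simp: xy_odd_def k i of_nat_diff)
      moreover have "3 * (k' - i') \<le> m + 2"
        using b0 by simp
      moreover have "3 * ((2 * i' + 2 * (k' - i') + 1) div 2) < m + 2 + 3 * (k' - i')"
        unfolding u using b0 True by simp
      ultimately show ?thesis
        using frob[of "2 * i'" "k' - i'"] unfolding u sum_half_even by simp
    next
      case False
      define z where "z = i' - (k' + 1)"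
      have i': "i' = z + k' + 1" using False by (simp add: z_def)
      have le: "z \<le> k'" using i_le i' by simp
      have u: "2 * z + 1 + 2 * (k' - z) = 2 * k' + 1" using le by simp
      have "x = int (2 * z + 1)" "y = int (k' - z)"
        using xy False le by (auto simp: xy_odd_def k i i' of_nat_diff)
      moreover have "3 * (k' - z) \<le> m + 2"
        using b0 by simp
      \<comment> \<open>The left side is 3 (k' + 1). If z < k', the term 3 (k' - z) \<ge> 3 makes
        \<open>b0\<close> suffice; z = k' is the last i', where \<open>b1\<close> applies.\<close>
      moreover have "3 * ((2 * z + 1 + 2 * (k' - z) + 1) div 2) < m + 2 + 3 * (k' - z)"
        unfolding u using b0 b1 i' le by (cases "z = k'") auto
      ultimately show ?thesis
        using frob[of "2 * z + 1" "k' - z"] unfolding u sum_odd i' by simp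
    qed
    then show ?thesis
      using AB tri(4) by simp
  qed
  then have pos: "A > 0" "B > 0" "coprime A B" and x: "x = int (nat x)"
    and main: "gen_frobenius [triangle n, A, B] s = gen_frobenius [A, B] x + y * int (triangle n)"
    by auto
  have "d1 dvd triangle (n + 2)" "d1 dvd triangle (n + 1)"
    using assms(10) by simp_all
  then have "triangle (n + 2) * triangle (n + 1) div d1 ^ 2 = A * B"
    by (simp add: A_def B_def power2_eq_square div_mult_div_if_dvd mult.commute)
  moreover have "gen_frobenius [A, B] x = (x + 1) * int (A * B) - int A - int B"
    using gen_frobenius_two[OF pos, of "nat x"] x by simp
  ultimately show ?thesis
    using main by (simp add: A_def B_def)
qed

end
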